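(* Let $M\ge 1$, let $Z=\mathrm{diag}(z_1,\dots,z_M)$ with $z_a\in\mathbb{C}$, and let $v_i$ $(i\in\mathbb{Z})$ and the phase-space coordinates $\xi^a_i,\eta^a_i$ $(a=1,\dots,M,\ i\in\mathbb{Z})$ with their Poisson bracket be as in the context. For $k\ge 0$ let $\tilde A^{[k]}$ be the $M\times M$ matrix with entries $$\tilde A^{[k]}_{ab}=\sum_{i\in\mathbb{Z}}v_i^{k}\,\xi^a_i\eta^b_i ,\qquad a,b=1,\dots,M,$$ and let $$\tilde T(v)=Z\Big(I+\sum_{k=1}^{\infty}\frac{\tilde A^{[k-1]}}{v^{k}}\Big),$$ a formal power series in $v^{-1}$ with $M\times M$ matrix coefficients. Then $$\{\tilde T_1(z),\tilde T_2(w)\}=\Big[\frac{P_{12}}{z-w},\ \tilde T_1(z)\tilde T_2(w)\Big],$$ where $P_{12}=\sum_{a,b=1}^{M}E_{ab}\otimes E_{ba}$. The identity is understood as the equality $(z-w)\{\tilde T_1(z),\tilde T_2(w)\}=[P_{12},\tilde T_1(z)\tilde T_2(w)]$ of formal series in $z^{-1},w^{-1}$, coefficient by coefficient.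
   Context: Constants: $v_i\in\mathbb{C}$, $i\in\mathbb{Z}$, are pairwise distinct and rapidly decaying: for every $n$, $|v_k|^2(1+k^2)^n\to 0$ as $|k|\to\infty$. Phase space: the coordinates are $\xi^a_i,\eta^a_i\in\mathbb{C}$, $a=1,\dots,M$, $i\in\mathbb{Z}$ (the Fourier modes of functions $\xi^a(\theta)=\sum_m\xi^a_me^{im\theta}$, $\eta^a(\theta)=\sum_m\eta^a_me^{im\theta}$ on the circle), whose absolute values decay faster than $|v_i|^2$, i.e. $|\xi^a_i|/|v_i|^2\to0$ and $|\eta^a_i|/|v_i|^2\to 0$ as $|i|\to\infty$. Poisson bracket of coordinates: $$\{\xi^a_i,\eta^b_j\}=-\delta_{ij}\Big(\delta^{ab}+\sum_{p\ne i}\frac{\xi^a_p\eta^b_p}{v_i-v_p}\Big)=-\{\eta^b_j,\xi^a_i\},$$ $$\{\xi^a_i,\xi^b_j\}=\frac{(1-\delta_{ij})\,\xi^a_j\xi^b_i}{v_i-v_j},\qquad \{\eta^a_i,\eta^b_j\}=\frac{(1-\delta_{ij})\,\eta^a_j\eta^b_i}{v_j-v_i},$$ where the terms with $i=j$ in the last two brackets are zero. It is extended by bilinearity and the Leibniz rule, termwise to series: $$\{F,G\}=\sum_{i\in\mathbb{Z}}\ \sum_{j\in\mathbb{Z}}\ \sum_{x\in X_i}\sum_{y\in X_j}\frac{\partial F}{\partial x}\frac{\partial G}{\partial y}\{x,y\},\qquad X_i=\{\xi^1_i,\dots,\xi^M_i,\eta^1_i,\dots,\eta^M_i\},$$ where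 for each $i$ the sum over $j$ is performed first, the summand for a pair $(i,j)$ being the finite sum over $X_i\times X_j$. Tensor notation: $E_{ab}$ are the standard $M\times M$ matrix units; for a matrix $X$, $X_1=X\otimes I$, $X_2=I\otimes X$; and $\{X_1,Y_2\}=\sum_{a,b,c,d=1}^{M}\{X_{ab},Y_{cd}\}\,E_{ab}\otimes E_{cd}$. *)

theory Defs
  imports "HOL-Analysis.Analysis" "HOL-Computational_Algebra.Formal_Laurent_Series"
begin

text \<open>
  The index set \<open>{1,\<dots>,M}\<close>, \<open>M \<ge> 1\<close>, is the type \<open>'m::finite\<close>; a point of phase space assigns a
  complex number to every coordinate.
\<close>

datatype 'm coord = Xi 'm int | Eta 'm int

type_synonym 'm point = "'m coord \<Rightarrow> complex"

abbreviation abs_to_infinity :: "int filter"  \<comment> \<open>the filter of \<open>\<bar>i\<bar> \<rightarrow> \<infinity>\<close>\<close>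
  where "abs_to_infinity \<equiv> filtercomap abs at_top"

definition rapidly_decaying :: "(int \<Rightarrow> complex) \<Rightarrow> bool" where
  "rapidly_decaying v \<longleftrightarrow>
     (\<forall>n::nat. ((\<lambda>k. (cmod (v k))\<^sup>2 * (1 + (real_of_int k)\<^sup>2) ^ n) \<longlongrightarrow> 0) abs_to_infinity)"

text \<open>At most one \<open>v i\<close> vanishes when \<open>v\<close> is injective, so the convention \<open>x / 0 = 0\<close> does not
  affect the limits below.\<close>

definition phase_space :: "(int \<Rightarrow> complex) \<Rightarrow> 'm::finite point set" where
  "phase_space v = {q. \<forall>a.
     ((\<lambda>i. cmod (q (Xi a i)) / (cmod (v i))\<^sup>2) \<longlongrightarrow> 0) abs_to_infinity \<and>
     ((\<lambda>i. cmod (q (Eta a i)) / (cmod (v i))\<^sup>2) \<longlongrightarrow> 0) abs_to_infinity}"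


section \<open>The Poisson bracket\<close>

definition xi_eta_bracket ::
  "(int \<Rightarrow> complex) \<Rightarrow> 'm::finite point \<Rightarrow> 'm \<Rightarrow> int \<Rightarrow> 'm \<Rightarrow> int \<Rightarrow> complex" where
  "xi_eta_bracket v q a i b j =
     - (if i = j then
          (if a = b then 1 else 0) +
          (\<Sum>\<^sub>\<infinity>p\<in>-{i}. q (Xi a p) * q (Eta b p) / (v i - v p))
        else 0)"

fun coord_bracket ::
  "(int \<Rightarrow> complex) \<Rightarrow> 'm::finite coord \<Rightarrow> 'm coord \<Rightarrow> 'm point \<Rightarrow> complex" where
  "coord_bracket v (Xi a i) (Eta b j) q = xi_eta_bracket v q a i b j"
| "coord_bracket v (Eta b j) (Xi a i) q = - xi_eta_bracket v q a i b j"
| "coord_bracket v (Xi a i) (Xi b j) q =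
     (if i = j then 0 else q (Xi a j) * q (Xi b i) / (v i - v j))"
| "coord_bracket v (Eta a i) (Eta b j) q =
     (if i = j then 0 else q (Eta a j) * q (Eta b i) / (v j - v i))"

definition partial_deriv :: "('m point \<Rightarrow> complex) \<Rightarrow> 'm coord \<Rightarrow> 'm point \<Rightarrow> complex" where
  "partial_deriv F x q = deriv (\<lambda>t. F (q(x := t))) (q x)"

definition coords_at :: "int \<Rightarrow> 'm::finite coord set" where
  "coords_at i = range (\<lambda>a. Xi a i) \<union> range (\<lambda>a. Eta a i)"

definition bracket_summand ::
  "(int \<Rightarrow> complex) \<Rightarrow> ('m::finite point \<Rightarrow> complex) \<Rightarrow> ('m point \<Rightarrow> complex) \<Rightarrow> 'm point \<Rightarrow>
   int \<Rightarrow> int \<Rightarrow> complex" where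
  "bracket_summand v F G q i j =
     (\<Sum>x\<in>coords_at i. \<Sum>y\<in>coords_at j.
        partial_deriv F x q * partial_deriv G y q * coord_bracket v x y q)"

definition bracket ::
  "(int \<Rightarrow> complex) \<Rightarrow> ('m::finite point \<Rightarrow> complex) \<Rightarrow> ('m point \<Rightarrow> complex) \<Rightarrow> 'm point \<Rightarrow> complex"
  where "bracket v F G q = (\<Sum>\<^sub>\<infinity>i. \<Sum>\<^sub>\<infinity>j. bracket_summand v F G q i j)"

text \<open>
  Because \<open>deriv\<close> and \<open>infsum\<close> are total, existence of all the derivatives and sums entering
  \<open>bracket v F G q\<close> is recorded separately.
\<close>

definition bracket_exists ::
  "(int \<Rightarrow> complex) \<Rightarrow> ('m::finite point \<Rightarrow> complex) \<Rightarrow> ('m point \<Rightarrow> complex) \<Rightarrow> 'm point \<Rightarrow> bool"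
  where
  "bracket_exists v F G q \<longleftrightarrow>
     (\<forall>x. (\<lambda>t. F (q(x := t))) field_differentiable at (q x)) \<and>
     (\<forall>x. (\<lambda>t. G (q(x := t))) field_differentiable at (q x)) \<and>
     (\<forall>a b i. (\<lambda>p. q (Xi a p) * q (Eta b p) / (v i - v p)) summable_on -{i}) \<and>
     (\<forall>i. bracket_summand v F G q i summable_on UNIV) \<and>
     (\<lambda>i. \<Sum>\<^sub>\<infinity>j. bracket_summand v F G q i j) summable_on UNIV"


section \<open>Matrices and tensor products\<close>

definition diag_matrix :: "('m \<Rightarrow> 'a::zero) \<Rightarrow> 'a^'m^'m" where
  "diag_matrix d = (\<chi> a b. if a = b then d a else 0)"

definition matrix_unit :: "'m \<Rightarrow> 'm \<Rightarrow> 'a::zero_neq_one^'m^'m" where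
  "matrix_unit a b = (\<chi> i j. if i = a \<and> j = b then 1 else 0)"

definition tensor :: "'a::times^'m^'m \<Rightarrow> 'a^'m^'m \<Rightarrow> 'a^('m \<times> 'm)^('m \<times> 'm)" where
  "tensor X Y = (\<chi> r s. X $ fst r $ fst s * Y $ snd r $ snd s)"

definition leg1 :: "'a::semiring_1^'m^'m \<Rightarrow> 'a^('m \<times> 'm)^('m \<times> 'm)" where
  "leg1 X = tensor X (mat 1)"

definition leg2 :: "'a::semiring_1^'m^'m \<Rightarrow> 'a^('m \<times> 'm)^('m \<times> 'm)" where
  "leg2 X = tensor (mat 1) X"

definition P12 :: "'a::semiring_1^('m::finite \<times> 'm)^('m \<times> 'm)" where
  "P12 = (\<Sum>a\<in>UNIV. \<Sum>b\<in>UNIV. tensor (matrix_unit a b) (matrix_unit b a))"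

definition commutator :: "'a::ring_1^'n^'n \<Rightarrow> 'a^'n^'n \<Rightarrow> 'a^'n::finite^'n" where
  "commutator X Y = X ** Y - Y ** X"


section \<open>Formal series in \<open>z\<inverse>\<close> and \<open>w\<inverse>\<close>\<close>

text \<open>
  Formal series in \<open>z\<inverse>\<close>, \<open>w\<inverse>\<close> with complex coefficients are elements of \<open>complex fls fls\<close>: the
  formal variable of the outer Laurent series is \<open>z\<inverse>\<close>, that of the inner one is \<open>w\<inverse>\<close>. Laurent
  series are needed since multiplication by \<open>z\<close> and \<open>w\<close> produces exponents \<open>-1\<close> of \<open>z\<inverse>\<close>, \<open>w\<inverse>\<close>.
  A matrix-valued series \<open>\<Sum>\<^sub>k X\<^sub>k v\<^sup>-\<^sup>k\<close> is given by its sequence of coefficients \<open>X\<close>, and is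
  identified with the matrix of the series of its entries.
\<close>

type_synonym zw_series = "complex fls fls"

definition var_z :: zw_series where "var_z = fls_X_inv"

definition var_w :: zw_series where "var_w = fls_const fls_X_inv"

definition series_zw :: "(nat \<Rightarrow> nat \<Rightarrow> complex) \<Rightarrow> zw_series" where
  \<comment> \<open>\<open>\<Sum>\<^sub>k\<^sub>,\<^sub>l f k l z\<^sup>-\<^sup>k w\<^sup>-\<^sup>l\<close>\<close>
  "series_zw f = fps_to_fls (Abs_fps (\<lambda>k. fps_to_fls (Abs_fps (f k))))"

definition in_z :: "(nat \<Rightarrow> complex^'m^'m) \<Rightarrow> zw_series^'m^'m" where
  "in_z X = (\<chi> a b. fps_to_fls (Abs_fps (\<lambda>k. fls_const (X k $ a $ b))))"

definition in_w :: "(nat \<Rightarrow> complex^'m^'m) \<Rightarrow> zw_series^'m^'m" where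
  "in_w X = (\<chi> a b. fls_const (fps_to_fls (Abs_fps (\<lambda>l. X l $ a $ b))))"

text \<open>
  \<open>{X\<^sub>1(z), Y\<^sub>2(w)}\<close> for series \<open>X\<close>, \<open>Y\<close> whose coefficients are matrix-valued functions on phase
  space. The factor \<open>mat c\<close> is multiplication by the scalar \<open>c\<close>.
\<close>

definition tensor_bracket ::
  "(int \<Rightarrow> complex) \<Rightarrow> (nat \<Rightarrow> 'm::finite point \<Rightarrow> complex^'m^'m) \<Rightarrow>
   (nat \<Rightarrow> 'm point \<Rightarrow> complex^'m^'m) \<Rightarrow> 'm point \<Rightarrow> zw_series^('m \<times> 'm)^('m \<times> 'm)" where
  "tensor_bracket v X Y q =
     (\<Sum>a\<in>UNIV. \<Sum>b\<in>UNIV. \<Sum>c\<in>UNIV. \<Sum>d\<in>UNIV.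
        mat (series_zw (\<lambda>k l. bracket v (\<lambda>q. X k q $ a $ b) (\<lambda>q. Y l q $ c $ d) q)) **
        tensor (matrix_unit a b) (matrix_unit c d))"


section \<open>The matrices \<open>A\<close> and \<open>T\<close>\<close>

definition A_tilde :: "(int \<Rightarrow> complex) \<Rightarrow> nat \<Rightarrow> 'm::finite point \<Rightarrow> complex^'m^'m" where
  "A_tilde v k q = (\<chi> a b. \<Sum>\<^sub>\<infinity>i. v i ^ k * q (Xi a i) * q (Eta b i))"

text \<open>\<open>T_tilde v zs k\<close> is the coefficient of \<open>v\<^sup>-\<^sup>k\<close> (here \<open>v\<close> is the spectral parameter).\<close>

definition T_tilde ::
  "(int \<Rightarrow> complex) \<Rightarrow> ('m::finite \<Rightarrow> complex) \<Rightarrow> nat \<Rightarrow> 'm point \<Rightarrow> complex^'m^'m" where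
  "T_tilde v zs k q = diag_matrix zs ** (if k = 0 then mat 1 else A_tilde v (k - 1) q)"

end

theory Submission
  imports Defs
begin

text \<open>
  Write \<open>S\<^sup>a\<^sup>b\<^sub>i = \<xi>\<^sup>a\<^sub>i \<eta>\<^sup>b\<^sub>i\<close> and \<open>A\<^sub>k = \<Sum>\<^sub>i v\<^sub>i\<^sup>k S\<^sub>i\<close>. In \<open>{A\<^sub>k\<^sup>a\<^sup>b, A\<^sub>l\<^sup>c\<^sup>d}\<close> the pair \<open>i \<noteq> j\<close>
  contributes \<open>v\<^sub>i\<^sup>k v\<^sub>j\<^sup>l (S\<^sup>c\<^sup>b\<^sub>i S\<^sup>a\<^sup>d\<^sub>j - S\<^sup>a\<^sup>d\<^sub>i S\<^sup>c\<^sup>b\<^sub>j) / (v\<^sub>i - v\<^sub>j)\<close>, which need not be jointly summable.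
  For fixed \<open>i\<close>, however, the series in the diagonal bracket \<open>i = j\<close> replaces \<open>v\<^sub>j\<^sup>l\<close> by
  \<open>v\<^sub>j\<^sup>l - v\<^sub>i\<^sup>l\<close>, so that the denominators cancel and each row sum is a polynomial in the \<open>A\<^sub>m\<close>, linear in
  \<open>S\<^sub>i\<close>. Summing over \<open>i\<close> gives
  \<open>{A\<^sub>k\<^sup>a\<^sup>b, A\<^sub>l\<^sup>c\<^sup>d} = \<delta>\<^sub>c\<^sub>b A\<^sup>a\<^sup>d\<^bsub>k+l\<^esub> - \<delta>\<^sub>a\<^sub>d A\<^sup>c\<^sup>b\<^bsub>k+l\<^esub> - \<Sum>\<^bsub>s<l\<^esub> (A\<^sup>c\<^sup>b\<^bsub>k+s\<^esub> A\<^sup>a\<^sup>d\<^bsub>l-1-s\<^esub> - A\<^sup>a\<^sup>d\<^bsub>k+s\<^esub> A\<^sup>c\<^sup>b\<^bsub>l-1-s\<^esub>)\<close>,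
  and passing from \<open>(k, l + 1)\<close> to \<open>(k + 1, l)\<close> leaves only one term of the sum: this is the identity
  for the coefficient of \<open>z\<^sup>-\<^sup>k w\<^sup>-\<^sup>l\<close>.
\<close>

unbundle no Formal_Power_Series.fps_syntax
unbundle Formal_Laurent_Series.fps_syntax

section \<open>Summability over the integers and algebra of sums\<close>

lemma summable_on_int_inverse_square:
  "(\<lambda>i::int. 1 / (1 + (real_of_int i)\<^sup>2)) summable_on UNIV"
proof -
  have s: "summable (\<lambda>n. 1 / (1 + (real n)\<^sup>2))"
  proof (rule summable_comparison_test_ev)
    show "summable (\<lambda>n. inverse (real n ^ 2))"
      by (rule inverse_power_summable) simp
    show "eventually (\<lambda>n. norm (1 / (1 + (real n)\<^sup>2)) \<le> inverse (real n ^ 2)) sequentially"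
      using eventually_gt_at_top[of 0]
      by eventually_elim (auto simp: inverse_eq_divide intro!: frac_le)
  qed
  then have nat: "(\<lambda>n::nat. 1 / (1 + (real n)\<^sup>2)) summable_on UNIV"
    by (subst summable_on_UNIV_nonneg_real_iff) auto
  have pos: "(\<lambda>i::int. 1 / (1 + (real_of_int i)\<^sup>2)) summable_on range int"
    using nat by (subst summable_on_reindex) (auto simp: o_def)
  have neg: "(\<lambda>i::int. 1 / (1 + (real_of_int i)\<^sup>2)) summable_on range (\<lambda>n. - int n)"
    using nat by (subst summable_on_reindex) (auto simp: o_def inj_def)
  have "UNIV = range int \<union> (range (\<lambda>n. - int n) - {0})"
    by (auto simp: image_iff) (metis int_cases2)
  moreover have "(\<lambda>i::int. 1 / (1 + (real_of_int i)\<^sup>2)) summable_on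
      range int \<union> (range (\<lambda>n. - int n) - {0})"
    by (intro summable_on_Un_disjoint pos summable_on_cofin_subset[OF neg]) auto
  ultimately show ?thesis by simp
qed

text \<open>Only finitely many indices can violate the bound, and adding a finite set keeps
  summability; completeness passes it on to every subset \<open>A\<close>.\<close>

lemma summable_on_int_comparison:
  fixes f :: "int \<Rightarrow> complex" and g :: "int \<Rightarrow> real"
  assumes "eventually (\<lambda>i. norm (f i) \<le> g i) abs_to_infinity" and "g summable_on UNIV"
  shows "f summable_on A"
proof -
  obtain N where N: "\<And>i. \<bar>i\<bar> \<ge> N \<Longrightarrow> norm (f i) \<le> g i"
    using assms(1) by (auto simp: eventually_filtercomap_at_top_linorder)
  let ?F = "{i::int. \<bar>i\<bar> < N}"
  have fin: "finite ?F"
    by (rule finite_subset[of _ "{-N..N}"]) auto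
  have "(\<lambda>i. norm (f i)) summable_on -?F"
    by (rule Infinite_Sum.abs_summable_on_comparison_test'[of g])
      (use N assms(2) in \<open>auto intro: summable_on_subset_banach\<close>)
  then have "f summable_on -?F"
    by (rule Infinite_Sum.abs_summable_summable)
  then have "f summable_on (-?F \<union> ?F)"
    by (intro summable_on_Un_disjoint) (use fin in auto)
  then show ?thesis
    by (rule summable_on_subset_banach) auto
qed

lemma rapidly_decaying_eventually_le:
  assumes "rapidly_decaying v"
  shows "eventually (\<lambda>k. cmod (v k) \<le> 1 / (1 + (real_of_int k)\<^sup>2)) abs_to_infinity"
proof -
  \<comment> \<open>The exponent 2 matches the square of \<open>cmod (v k)\<close>, so that taking
    roots leaves the summable majorant.\<close>
  have "((\<lambda>k. (cmod (v k))\<^sup>2 * (1 + (real_of_int k)\<^sup>2) ^ 2) \<longlongrightarrow> 0) abs_to_infinity"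
    using assms by (auto simp: rapidly_decaying_def)
  then have "eventually (\<lambda>k. (cmod (v k))\<^sup>2 * (1 + (real_of_int k)\<^sup>2) ^ 2 < 1) abs_to_infinity"
    by (rule order_tendstoD) simp
  then show ?thesis
  proof eventually_elim
    case (elim k)
    have "(cmod (v k) * (1 + (real_of_int k)\<^sup>2))\<^sup>2 \<le> 1\<^sup>2"
      using elim by (simp add: power_mult_distrib)
    then have "cmod (v k) * (1 + (real_of_int k)\<^sup>2) \<le> 1"
      by (rule power2_le_imp_le) simp
    moreover have "1 + (real_of_int k)\<^sup>2 > 0"
      by (simp add: add_pos_nonneg)
    ultimately show ?case by (simp add: field_simps)
  qed
qed

lemma rapidly_decaying_tendsto_0:
  assumes "rapidly_decaying v"
  shows "(v \<longlongrightarrow> 0) abs_to_infinity"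
proof -
  have "((\<lambda>k. (cmod (v k))\<^sup>2 * (1 + (real_of_int k)\<^sup>2) ^ 0) \<longlongrightarrow> 0) abs_to_infinity"
    using assms by (auto simp only: rapidly_decaying_def)
  then have "((\<lambda>k. sqrt ((cmod (v k))\<^sup>2)) \<longlongrightarrow> sqrt 0) abs_to_infinity"
    by (intro tendsto_real_sqrt) simp
  then show ?thesis
    by (simp add: tendsto_norm_zero_iff)
qed

lemma eventually_neq_abs_to_infinity: "eventually (\<lambda>i. i \<noteq> j) abs_to_infinity"
  unfolding eventually_filtercomap_at_top_linorder by (intro exI[of _ "\<bar>j\<bar> + 1"]) auto

lemma has_sum_diff:
  fixes f g :: "'a \<Rightarrow> 'b::topological_ab_group_add"
  assumes "(f has_sum x) B" and "(g has_sum y) B"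
  shows "((\<lambda>i. f i - g i) has_sum (x - y)) B"
  using has_sum_add[OF assms(1), of "\<lambda>i. - g i" "- y"] assms(2) by (simp add: has_sum_uminus)

lemma has_sum_sum:
  fixes f :: "'a \<Rightarrow> 'b \<Rightarrow> 'c::topological_comm_monoid_add"
  assumes "\<And>i. i \<in> I \<Longrightarrow> (f i has_sum x i) B"
  shows "((\<lambda>j. \<Sum>i\<in>I. f i j) has_sum (\<Sum>i\<in>I. x i)) B"
  using assms by (induction I rule: infinite_finite_induct) (auto intro: has_sum_add)

lemma diff_power_eq_times_sum:
  fixes x y :: "'a::comm_ring_1"
  shows "x ^ l - y ^ l = (x - y) * (\<Sum>s<l. x ^ s * y ^ (l - 1 - s))"
proof (cases l)
  case (Suc n)
  then show ?thesis
    by (simp only: diff_power_eq_sum) (simp add: mult.commute)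
qed simp

section \<open>Decay on phase space and convergence of the mode sums\<close>

context
  fixes v :: "int \<Rightarrow> complex" and q :: "'m::finite point"
  assumes inj_v: "inj v"
    and decay: "rapidly_decaying v"
    and q: "q \<in> phase_space v"
begin

abbreviation res :: "'m \<Rightarrow> 'm \<Rightarrow> int \<Rightarrow> complex" where
  "res a b i \<equiv> q (Xi a i) * q (Eta b i)"

abbreviation mom :: "nat \<Rightarrow> 'm \<Rightarrow> 'm \<Rightarrow> complex" where
  "mom k a b \<equiv> A_tilde v k q $ a $ b"

text \<open>The closed form of the bracket of \<open>mom k a b\<close> with
  \<open>mom l c d\<close>. Its form is not symmetric in \<open>k\<close> and \<open>l\<close>: the
  sum over \<open>j\<close> comes first, so the divided difference is taken of the power
  \<open>l\<close>.\<close>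

definition mom_bracket :: "nat \<Rightarrow> nat \<Rightarrow> 'm \<Rightarrow> 'm \<Rightarrow> 'm \<Rightarrow> 'm \<Rightarrow> complex" where
  "mom_bracket k l a b c d =
     of_bool (c = b) * mom (k + l) a d - of_bool (a = d) * mom (k + l) c b
     - (\<Sum>s<l. mom (k + s) c b * mom (l - 1 - s) a d - mom (k + s) a d * mom (l - 1 - s) c b)"

text \<open>Injectivity allows at most one zero of \<open>v\<close>; beyond it the quotients in
  \<open>phase_space\<close> are genuine and can be turned into bounds.\<close>

lemma eventually_v_nonzero: "eventually (\<lambda>i. v i \<noteq> 0) abs_to_infinity"
proof (cases "\<exists>j. v j = 0")
  case True
  then obtain j where "v j = 0" by blast
  then have "i \<noteq> j \<Longrightarrow> v i \<noteq> 0" for i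
    using inj_v by (metis injD)
  then show ?thesis
    by (rule eventually_mono[OF eventually_neq_abs_to_infinity[of j]])
qed auto

lemma eventually_coord_le:
  shows "eventually (\<lambda>i. cmod (q (Xi a i)) \<le> (cmod (v i))\<^sup>2) abs_to_infinity"
    and "eventually (\<lambda>i. cmod (q (Eta a i)) \<le> (cmod (v i))\<^sup>2) abs_to_infinity"
proof -
  have *: "eventually (\<lambda>i. cmod (f i) \<le> (cmod (v i))\<^sup>2) abs_to_infinity"
    if "((\<lambda>i. cmod (f i) / (cmod (v i))\<^sup>2) \<longlongrightarrow> 0) abs_to_infinity" for f :: "int \<Rightarrow> complex"
  proof -
    have "eventually (\<lambda>i. cmod (f i) / (cmod (v i))\<^sup>2 < 1) abs_to_infinity"
      using that by (rule order_tendstoD) simp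
    with eventually_v_nonzero show ?thesis
      by eventually_elim (simp add: field_simps)
  qed
  show "eventually (\<lambda>i. cmod (q (Xi a i)) \<le> (cmod (v i))\<^sup>2) abs_to_infinity"
    and "eventually (\<lambda>i. cmod (q (Eta a i)) \<le> (cmod (v i))\<^sup>2) abs_to_infinity"
    using q by (auto simp: phase_space_def intro!: *)
qed

text \<open>Decay of both coordinates gives a fourth power of \<open>cmod (v i)\<close>; the square
  suffices. One factor can be spent on a denominator \<open>v i - v p\<close>, and the other is
  summable.\<close>

lemma eventually_res_le:
  "eventually (\<lambda>i. cmod (res a b i) \<le> (cmod (v i)) ^ 2 \<and> cmod (v i) \<le> 1 / (1 + (real_of_int i)\<^sup>2) \<and>
     cmod (v i) \<le> 1) abs_to_infinity"
  using eventually_coord_le(1)[of a] eventually_coord_le(2)[of b]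
    rapidly_decaying_eventually_le[OF decay]
proof eventually_elim
  case (elim i)
  have "cmod (v i) \<le> 1"
    by (rule order.trans[OF elim(3)]) (simp add: field_simps add_pos_nonneg)
  moreover have "cmod (res a b i) \<le> (cmod (v i))\<^sup>2 * (cmod (v i))\<^sup>2"
    unfolding norm_mult by (intro mult_mono elim) auto
  moreover have "(cmod (v i))\<^sup>2 * (cmod (v i))\<^sup>2 \<le> (cmod (v i))\<^sup>2 * 1"
    using calculation(1) by (intro mult_left_mono) (auto simp: power_le_one)
  ultimately show ?case using elim by auto
qed

lemma summable_mom: "(\<lambda>i. v i ^ k * res a b i) summable_on B"
proof (rule summable_on_int_comparison[OF _ summable_on_int_inverse_square])
  show "eventually (\<lambda>i. cmod (v i ^ k * res a b i) \<le> 1 / (1 + (real_of_int i)\<^sup>2)) abs_to_infinity"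
    using eventually_res_le[of a b]
  proof eventually_elim
    case (elim i)
    have "cmod (v i ^ k * res a b i) \<le> 1 * (cmod (v i) ^ 2)"
      unfolding norm_mult[of "v i ^ k"] norm_power using elim by (intro mult_mono power_le_one) auto
    also have "\<dots> \<le> cmod (v i)"
      using elim by (simp add: power2_eq_square mult_left_le)
    finally show ?case using elim by linarith
  qed
qed

lemma has_sum_mom: "((\<lambda>i. v i ^ k * res a b i) has_sum mom k a b) UNIV"
  using has_sum_infsum[OF summable_mom[of k a b UNIV]] by (simp add: A_tilde_def mult.assoc)

text \<open>For \<open>v i = 0\<close> the denominator tends to \<open>0\<close> as well, but only as fast as \<open>v p\<close>.\<close>

lemma summable_resolvent: "(\<lambda>p. res a b p / (v i - v p)) summable_on B"
proof (rule summable_on_int_comparison[OF _ summable_on_int_inverse_square])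
  have "eventually (\<lambda>p. cmod (v p) \<le> cmod (v i - v p)) abs_to_infinity"
  proof (cases "v i = 0")
    case False
    have "eventually (\<lambda>p. dist (v p) 0 < cmod (v i) / 2) abs_to_infinity"
      using rapidly_decaying_tendsto_0[OF decay] by (rule tendstoD) (use False in simp)
    then show ?thesis
    proof eventually_elim
      case (elim p)
      then show ?case using norm_triangle_ineq2[of "v i" "v p"] by simp
    qed
  qed simp
  then show "eventually (\<lambda>p. cmod (res a b p / (v i - v p)) \<le> 1 / (1 + (real_of_int p)\<^sup>2)) abs_to_infinity"
    using eventually_res_le[of a b] eventually_v_nonzero
  proof eventually_elim
    case (elim p)
    have "cmod (res a b p / (v i - v p)) \<le> cmod (v p) ^ 2 / cmod (v p)"
      unfolding norm_divide using elim by (intro frac_le) auto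
    also have "\<dots> = cmod (v p)"
      by (simp add: power2_eq_square)
    finally show ?case using elim by linarith
  qed
qed

text \<open>Splitting off the divided difference \<open>(v i ^ l - v j ^ l) / (v i - v j)\<close> reduces these
  sums to the resolvent sum \<open>l = 0\<close>, which then cancels against the diagonal bracket.\<close>

lemma has_sum_weighted_resolvent:
  "((\<lambda>j. v j ^ l * res a b j / (v i - v j)) has_sum
     (v i ^ l * (\<Sum>\<^sub>\<infinity>p\<in>-{i}. res a b p / (v i - v p))
      - ((\<Sum>s<l. v i ^ s * mom (l - 1 - s) a b) - (\<Sum>s<l. v i ^ s * v i ^ (l - 1 - s)) * res a b i))) (-{i})"
proof -
  let ?h = "\<lambda>j. (\<Sum>s<l. v i ^ s * v j ^ (l - 1 - s)) * res a b j"
  have h: "(?h has_sum (\<Sum>s<l. v i ^ s * mom (l - 1 - s) a b)) UNIV"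
    unfolding sum_distrib_right mult.assoc
    by (intro has_sum_sum has_sum_cmult_right has_sum_mom)
  have "(?h has_sum ((\<Sum>s<l. v i ^ s * mom (l - 1 - s) a b) - ?h i)) (UNIV - {i})"
    by (intro has_sum_Diff h) (auto simp: has_sum_finite_iff)
  then have h': "(?h has_sum ((\<Sum>s<l. v i ^ s * mom (l - 1 - s) a b) - ?h i)) (-{i})"
    by (simp add: Compl_eq_Diff_UNIV)
  have "((\<lambda>j. v i ^ l * (res a b j / (v i - v j)) - ?h j) has_sum
     (v i ^ l * (\<Sum>\<^sub>\<infinity>p\<in>-{i}. res a b p / (v i - v p))
      - ((\<Sum>s<l. v i ^ s * mom (l - 1 - s) a b) - ?h i))) (-{i})"
    by (intro has_sum_diff has_sum_cmult_right has_sum_infsum summable_resolvent h')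
  moreover have "v i ^ l * (res a b j / (v i - v j)) - ?h j = v j ^ l * res a b j / (v i - v j)"
    if "j \<in> -{i}" for j
  proof -
    define h where "h = (\<Sum>s<l. v i ^ s * v j ^ (l - 1 - s))"
    have nz: "v i - v j \<noteq> 0" using that inj_v by (auto dest: injD)
    have "v j ^ l = v i ^ l - (v i - v j) * h"
      unfolding h_def diff_power_eq_times_sum[symmetric] by (rule add_implies_diff) simp
    then have "v j ^ l * res a b j / (v i - v j) = (v i ^ l - (v i - v j) * h) * res a b j / (v i - v j)"
      by (rule arg_cong)
    also have "\<dots> = v i ^ l * (res a b j / (v i - v j)) - h * res a b j"
    proof -
      have "(x - d * h) * r / d = x * (r / d) - h * r" if "d \<noteq> 0" for x d r :: complex
        using that by (simp add: field_simps)
      then show ?thesis using nz by blast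
    qed
    finally show ?thesis unfolding h_def ..
  qed
  ultimately show ?thesis by (subst (asm) has_sum_cong) auto
qed

section \<open>Partial derivatives of the moments and of the entries of
  \<open>T_tilde\<close>\<close>

definition dmom :: "nat \<Rightarrow> 'm \<Rightarrow> 'm \<Rightarrow> 'm coord \<Rightarrow> complex" where
  "dmom k a b x = (case x of
      Xi e i \<Rightarrow> if e = a then v i ^ k * q (Eta b i) else 0
    | Eta e i \<Rightarrow> if e = b then v i ^ k * q (Xi a i) else 0)"

text \<open>Changing one coordinate alters only the summand of its mode, and that affinely, since
  each summand is a product of two distinct coordinates. Hence no infinite series has to be
  differentiated termwise.\<close>

lemma A_tilde_upd: "A_tilde v k (q(x := t)) $ a $ b = mom k a b + (t - q x) * dmom k a b x"
proof -
  define i0 where "i0 = (case x of Xi e i \<Rightarrow> i | Eta e i \<Rightarrow> i)"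
  have "((\<lambda>i. v i ^ k * res a b i + (if i = i0 then (t - q x) * dmom k a b x else 0)) has_sum
      (mom k a b + (t - q x) * dmom k a b x)) UNIV"
    by (intro has_sum_add has_sum_mom has_sum_finite_neutralI[of "{i0}"]) auto
  moreover have "v i ^ k * res a b i + (if i = i0 then (t - q x) * dmom k a b x else 0) =
      v i ^ k * (q(x := t)) (Xi a i) * (q(x := t)) (Eta b i)" for i
    by (cases x) (auto simp: i0_def dmom_def algebra_simps)
  ultimately show ?thesis
    by (simp add: A_tilde_def infsumI)
qed

lemma T_tilde_entry:
  "T_tilde v zs k p $ a $ b =
     (if k = 0 then if a = b then zs a else 0 else zs a * A_tilde v (k - 1) p $ a $ b)"
  by (simp add: T_tilde_def diag_matrix_def matrix_matrix_mult_def mat_def if_distrib[of "\<lambda>x. x * _"]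
      cong: if_cong)

text \<open>At \<open>k = 0\<close> the entry is the constant \<open>Z\<close>; the factor 0 then
  makes the truncated \<open>k - 1\<close> harmless.\<close>

lemma T_tilde_has_field_derivative:
  "((\<lambda>t. T_tilde v zs k (q(x := t)) $ a $ b) has_field_derivative
     (if k = 0 then 0 else zs a) * dmom (k - 1) a b x) (at (q x))"
  by (cases "k = 0") (auto simp: T_tilde_entry A_tilde_upd intro!: derivative_eq_intros)

section \<open>Row sums and total sum of the bracket\<close>

lemma sum_coords_at:
  fixes f :: "'m coord \<Rightarrow> complex"
  shows "(\<Sum>x\<in>coords_at i. f x) = (\<Sum>e\<in>UNIV. f (Xi e i)) + (\<Sum>e\<in>UNIV. f (Eta e i))"
proof -
  have "(\<Sum>x\<in>coords_at i. f x) =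
      (\<Sum>x\<in>range (\<lambda>e. Xi e i). f x) + (\<Sum>x\<in>range (\<lambda>e. Eta e i). f x)"
    unfolding coords_at_def by (rule sum.union_disjoint) auto
  then show ?thesis
    by (simp add: sum.reindex inj_def)
qed

lemma sum_dmom:
  "(\<Sum>x\<in>coords_at i. dmom k a b x * f x) =
     v i ^ k * (q (Eta b i) * f (Xi a i) + q (Xi a i) * f (Eta b i))"
  by (simp add: sum_coords_at dmom_def if_distrib[of "\<lambda>x. x * _"] distrib_left mult.assoc
      cong: if_cong)

text \<open>Only the gradients enter the bracket. The scalars \<alpha> and \<beta> let one
  computation cover all entries of \<open>T_tilde\<close>, including the constant ones, where the
  scalar is 0.\<close>

context
  fixes F G :: "'m point \<Rightarrow> complex" and \<alpha> \<beta> :: complex and k l :: nat and a b c d :: 'm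
  assumes F: "\<And>x. partial_deriv F x q = \<alpha> * dmom k a b x"
    and G: "\<And>x. partial_deriv G x q = \<beta> * dmom l c d x"
begin

lemma bracket_summand_eq:
  "bracket_summand v F G q i j =
     \<alpha> * \<beta> * (v i ^ k * v j ^ l *
       (q (Eta b i) * (q (Eta d j) * coord_bracket v (Xi a i) (Xi c j) q
                     + q (Xi c j) * coord_bracket v (Xi a i) (Eta d j) q)
      + q (Xi a i) * (q (Eta d j) * coord_bracket v (Eta b i) (Xi c j) q
                     + q (Xi c j) * coord_bracket v (Eta b i) (Eta d j) q)))"
proof -
  have "bracket_summand v F G q i j =
      \<alpha> * \<beta> * (\<Sum>x\<in>coords_at i. dmom k a b x *
        (\<Sum>y\<in>coords_at j. dmom l c d y * coord_bracket v x y q))"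
    unfolding bracket_summand_def F G sum_distrib_left
    by (intro sum.cong refl) (simp add: mult_ac)
  then show ?thesis
    unfolding sum_dmom by (simp only: algebra_simps)
qed

text \<open>Off the diagonal the mixed brackets vanish. The other two exchange the modes of their
  arguments, which regroups the four coordinates into \<open>res c b\<close> and
  \<open>res a d\<close>.\<close>

lemma bracket_summand_neq:
  assumes "i \<noteq> j"
  shows "bracket_summand v F G q i j =
     \<alpha> * \<beta> * (v i ^ k * res c b i * (v j ^ l * res a d j / (v i - v j))
        - v i ^ k * res a d i * (v j ^ l * res c b j / (v i - v j)))"
proof -
  have "v i - v j \<noteq> 0" "v j - v i \<noteq> 0" using assms inj_v by (auto dest: injD)
  then have "1 / (v j - v i) = - (1 / (v i - v j))" by (simp add: divide_simps)
  then have "x / (v j - v i) = - (x / (v i - v j))" for x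
    by (metis divide_minus_left minus_diff_eq minus_divide_divide)
  then show ?thesis
    using assms by (simp add: bracket_summand_eq xi_eta_bracket_def algebra_simps diff_divide_distrib)
qed

lemma bracket_summand_diag:
  "bracket_summand v F G q i i =
     \<alpha> * \<beta> * v i ^ (k + l) *
       (res a d i * (of_bool (c = b) + (\<Sum>\<^sub>\<infinity>p\<in>-{i}. res c b p / (v i - v p)))
        - res c b i * (of_bool (a = d) + (\<Sum>\<^sub>\<infinity>p\<in>-{i}. res a d p / (v i - v p))))"
  by (simp add: bracket_summand_eq xi_eta_bracket_def power_add of_bool_def algebra_simps)

lemma has_sum_bracket_row:
  "(bracket_summand v F G q i has_sum
     \<alpha> * \<beta> * (of_bool (c = b) * (v i ^ (k + l) * res a d i) - of_bool (a = d) * (v i ^ (k + l) * res c b i)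
       - (\<Sum>s<l. v i ^ (k + s) * res c b i * mom (l - 1 - s) a d
                - v i ^ (k + s) * res a d i * mom (l - 1 - s) c b))) UNIV"
proof -
  define W where "W a b = (\<Sum>\<^sub>\<infinity>p\<in>-{i}. res a b p / (v i - v p))" for a b
  define H where "H a b = (\<Sum>s<l. v i ^ s * mom (l - 1 - s) a b)" for a b
  define h where "h = (\<Sum>s<l. v i ^ s * v i ^ (l - 1 - s))"
  have "((\<lambda>j. \<alpha> * \<beta> * (v i ^ k * res c b i * (v j ^ l * res a d j / (v i - v j))
          - v i ^ k * res a d i * (v j ^ l * res c b j / (v i - v j)))) has_sum
      \<alpha> * \<beta> * (v i ^ k * res c b i * (v i ^ l * W a d - (H a d - h * res a d i))
          - v i ^ k * res a d i * (v i ^ l * W c b - (H c b - h * res c b i)))) (-{i})"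
    unfolding W_def H_def h_def
    by (intro has_sum_cmult_right has_sum_diff has_sum_weighted_resolvent)
  then have "(bracket_summand v F G q i has_sum
      \<alpha> * \<beta> * (v i ^ k * res c b i * (v i ^ l * W a d - (H a d - h * res a d i))
          - v i ^ k * res a d i * (v i ^ l * W c b - (H c b - h * res c b i)))) (-{i})"
    by (subst has_sum_cong[OF bracket_summand_neq]) auto
  then have "(bracket_summand v F G q i has_sum (bracket_summand v F G q i i +
      \<alpha> * \<beta> * (v i ^ k * res c b i * (v i ^ l * W a d - (H a d - h * res a d i))
          - v i ^ k * res a d i * (v i ^ l * W c b - (H c b - h * res c b i))))) (insert i (-{i}))"
    by (intro has_sum_insert) auto
  moreover have "insert i (-{i}) = UNIV" by auto
  \<comment> \<open>The resolvent sums \<open>W\<close> cancel against the diagonal bracket. The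
    corrections with \<open>h\<close>, due to omitting \<open>j = i\<close>, cancel by antisymmetry
    under exchanging \<open>(a, d)\<close> and \<open>(c, b)\<close>.\<close>
  moreover have "bracket_summand v F G q i i +
      \<alpha> * \<beta> * (v i ^ k * res c b i * (v i ^ l * W a d - (H a d - h * res a d i))
          - v i ^ k * res a d i * (v i ^ l * W c b - (H c b - h * res c b i))) =
      \<alpha> * \<beta> * (of_bool (c = b) * (v i ^ (k + l) * res a d i) - of_bool (a = d) * (v i ^ (k + l) * res c b i)
       - (v i ^ k * res c b i * H a d - v i ^ k * res a d i * H c b))"
    unfolding bracket_summand_diag W_def[symmetric] power_add by (simp only: algebra_simps)
  moreover have "v i ^ k * res c b i * H a d - v i ^ k * res a d i * H c b =
      (\<Sum>s<l. v i ^ (k + s) * res c b i * mom (l - 1 - s) a d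
              - v i ^ (k + s) * res a d i * mom (l - 1 - s) c b)"
    unfolding H_def sum_distrib_left sum_subtractf[symmetric]
    by (intro sum.cong refl) (simp add: power_add mult_ac)
  ultimately show ?thesis by simp
qed

lemma has_sum_bracket:
  "((\<lambda>i. \<Sum>\<^sub>\<infinity>j. bracket_summand v F G q i j) has_sum \<alpha> * \<beta> * mom_bracket k l a b c d) UNIV"
  unfolding infsumI[OF has_sum_bracket_row] mom_bracket_def
  by (intro has_sum_cmult_right has_sum_diff has_sum_sum has_sum_cmult_left has_sum_mom)

end

section \<open>Brackets of the entries of \<open>T_tilde\<close> and their recursion\<close>

lemma mom_bracket_Suc:
  "mom_bracket (Suc k) l a b c d - mom_bracket k (Suc l) a b c d =
     mom k c b * mom l a d - mom k a d * mom l c b"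
  \<comment> \<open>The linear terms depend only on \<open>k + l\<close>. After the shift the longer
    sum exceeds the other by its term \<open>s = 0\<close>.\<close>
  unfolding mom_bracket_def sum.lessThan_Suc_shift by simp

text \<open>For \<open>k = 0\<close> the reflection \<open>s\<close> to \<open>l - 1 - s\<close>
  swaps the two products, so the quadratic part vanishes; for \<open>l = 0\<close> it is empty.
  These are the boundary cases of the recursion.\<close>

lemma mom_bracket_0:
  shows "mom_bracket 0 l a b c d = of_bool (c = b) * mom l a d - of_bool (a = d) * mom l c b"
    and "mom_bracket k 0 a b c d = of_bool (c = b) * mom k a d - of_bool (a = d) * mom k c b"
proof -
  have "(\<Sum>s<l. mom (l - 1 - s) c b * mom s a d) = (\<Sum>s<l. mom s c b * mom (l - 1 - s) a d)"
    using sum.nat_diff_reindex[of "\<lambda>s. mom s c b * mom (l - 1 - s) a d" l]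
    by (subst sum.nat_diff_reindex[symmetric]) (auto intro!: sum.cong)
  then show "mom_bracket 0 l a b c d = of_bool (c = b) * mom l a d - of_bool (a = d) * mom l c b"
    unfolding mom_bracket_def by (simp add: sum_subtractf mult.commute)
qed (simp add: mom_bracket_def)

lemma partial_deriv_T_tilde:
  "partial_deriv (\<lambda>p. T_tilde v zs k p $ a $ b) x q =
     (if k = 0 then 0 else zs a) * dmom (k - 1) a b x"
  unfolding partial_deriv_def by (rule DERIV_imp_deriv[OF T_tilde_has_field_derivative])

lemma bracket_exists_T_tilde:
  "bracket_exists v (\<lambda>p. T_tilde v zs k p $ a $ b) (\<lambda>p. T_tilde v zs l p $ c $ d) q"
  unfolding bracket_exists_def field_differentiable_def
  by (intro conjI allI exI summable_resolvent
      has_sum_imp_summable[OF has_sum_bracket_row[OF partial_deriv_T_tilde partial_deriv_T_tilde]]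
      has_sum_imp_summable[OF has_sum_bracket[OF partial_deriv_T_tilde partial_deriv_T_tilde]])
    (rule T_tilde_has_field_derivative)+

lemma bracket_T_tilde:
  "bracket v (\<lambda>p. T_tilde v zs k p $ a $ b) (\<lambda>p. T_tilde v zs l p $ c $ d) q =
     (if k = 0 then 0 else zs a) * (if l = 0 then 0 else zs c) * mom_bracket (k - 1) (l - 1) a b c d"
  unfolding bracket_def by (intro infsumI has_sum_bracket partial_deriv_T_tilde)

lemma bracket_T_tilde_rec:
  "bracket v (\<lambda>p. T_tilde v zs (Suc k) p $ a $ b) (\<lambda>p. T_tilde v zs l p $ c $ d) q
   - bracket v (\<lambda>p. T_tilde v zs k p $ a $ b) (\<lambda>p. T_tilde v zs (Suc l) p $ c $ d) q =
   T_tilde v zs k q $ c $ b * T_tilde v zs l q $ a $ d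
   - T_tilde v zs k q $ a $ d * T_tilde v zs l q $ c $ b"
  (is "?lhs = ?rhs")
proof (cases k; cases l)
  fix k' l' assume [simp]: "k = Suc k'" "l = Suc l'"
  have "?lhs = zs a * zs c * (mom_bracket (Suc k') l' a b c d - mom_bracket k' (Suc l') a b c d)"
    by (simp add: bracket_T_tilde right_diff_distrib)
  also have "\<dots> = ?rhs"
    unfolding mom_bracket_Suc by (simp add: T_tilde_entry right_diff_distrib mult_ac)
  finally show ?thesis .
\<comment> \<open>If \<open>k\<close> or \<open>l\<close> is 0, the diagonal matrix \<open>Z\<close>
  on the right supplies the Kronecker deltas of \<open>mom_bracket_0\<close>.\<close>
qed (simp_all only: bracket_T_tilde, auto simp: T_tilde_entry mom_bracket_0 right_diff_distrib)

end

section \<open>Coefficients of formal series and entries of tensor products\<close>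

lemma series_zw_nth:
  "series_zw f $$ n $$ m = (if n < 0 \<or> m < 0 then 0 else f (nat n) (nat m))"
  by (simp add: series_zw_def)

text \<open>Each variable shifts one index by one; the vanishing coefficients of index 0 exclude
  positive powers of \<open>z\<close> and \<open>w\<close> from the product.\<close>

lemma var_z_minus_var_w_times_series_zw:
  assumes "\<And>m. f 0 m = 0" and "\<And>n. f n 0 = 0"
  shows "(var_z - var_w) * series_zw f = series_zw (\<lambda>n m. f (Suc n) m - f n (Suc m))"
proof (intro fls_eqI)
  fix n m
  have nat_add_1: "nat (x + 1) = (if x < 0 then 0 else Suc (nat x))" for x
    by (auto simp: nat_eq_iff)
  show "((var_z - var_w) * series_zw f) $$ n $$ m =
      series_zw (\<lambda>n m. f (Suc n) m - f n (Suc m)) $$ n $$ m"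
    using assms
    by (auto simp: var_z_def var_w_def left_diff_distrib fls_X_inv_times_conv_shift
        series_zw_nth nat_add_1)
qed

lemma in_z_times_in_w:
  "in_z X $ a $ b * in_w Y $ c $ d = series_zw (\<lambda>k l. X k $ a $ b * Y l $ c $ d)"
  by (intro fls_eqI) (simp add: in_z_def in_w_def series_zw_nth)

lemma mat_times_nth: "(mat x ** X) $ r $ s = x * X $ r $ s"
  for X :: "'a::semiring_1 ^ 'n ^ 'n::finite"
  by (simp add: matrix_matrix_mult_def mat_def if_distrib[of "\<lambda>x. x * _"] cong: if_cong)

text \<open>The conditionals are nested so that the innermost summation index is tested first, and
  the four sums collapse one by one.\<close>

lemma tensor_matrix_unit_nth:
  "tensor (matrix_unit a b) (matrix_unit c d) $ r $ s =
     (if d = snd s then if c = snd r then if b = fst s then if a = fst r then 1 else 0 else 0 else 0 else 0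
       :: 'a::semiring_1)"
  by (auto simp: tensor_def matrix_unit_def)

lemma tensor_bracket_nth:
  "tensor_bracket v X Y q $ (a, c) $ (b, d) =
     series_zw (\<lambda>k l. bracket v (\<lambda>q. X k q $ a $ b) (\<lambda>q. Y l q $ c $ d) q)"
  by (simp add: tensor_bracket_def mat_times_nth tensor_matrix_unit_nth if_distrib[of "\<lambda>x. _ * x"]
      cong: if_cong)

lemma P12_nth: "P12 $ r $ s = (if s = (snd r, fst r) then 1 else 0 :: 'a::semiring_1)"
proof -
  have "tensor (matrix_unit a b) (matrix_unit b a) $ r $ s =
      (if b = snd r then if a = fst r then if s = (snd r, fst r) then 1 else 0 else 0 else 0 :: 'a)"
    for a b
    by (cases s) (auto simp: tensor_matrix_unit_nth)
  then show ?thesis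
    by (simp add: P12_def)
qed

text \<open>\<open>P12\<close> is the flip: on the left it exchanges the two row indices, on the
  right the two column indices.\<close>

lemma commutator_P12_nth:
  "commutator P12 X $ (a, c) $ (b, d) = X $ (c, a) $ (b, d) - X $ (a, c) $ (d, b)"
proof -
  have "(X ** P12) $ (a, c) $ (b, d) = (\<Sum>r\<in>UNIV. if r = (d, b) then X $ (a, c) $ r else 0)"
    unfolding matrix_matrix_mult_def vec_lambda_beta by (rule sum.cong) (auto simp: P12_nth)
  then show ?thesis
    by (simp add: commutator_def matrix_matrix_mult_def[of P12] P12_nth if_distrib[of "\<lambda>x. x * _"]
        cong: if_cong)
qed

lemma leg1_times_leg2_nth: "(leg1 X ** leg2 Y) $ (a, c) $ (b, d) = X $ a $ b * Y $ c $ d"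
proof -
  have "(leg1 X ** leg2 Y) $ (a, c) $ (b, d) =
      (\<Sum>r\<in>UNIV. if r = (b, c) then X $ a $ b * Y $ c $ d else 0)"
    unfolding matrix_matrix_mult_def vec_lambda_beta
    by (rule sum.cong) (auto simp: leg1_def leg2_def tensor_def mat_def)
  then show ?thesis by simp
qed

theorem lemma4p1:
  fixes v :: "int \<Rightarrow> complex"
    and zs :: "'m::finite \<Rightarrow> complex"
    and q :: "'m point"
  assumes "inj v"
    and "rapidly_decaying v"
    and "q \<in> phase_space v"
  shows "(\<forall>k a b. (\<lambda>i. v i ^ k * q (Xi a i) * q (Eta b i)) summable_on UNIV) \<and>
    (\<forall>k l a b c d.
       bracket_exists v (\<lambda>q. T_tilde v zs k q $ a $ b) (\<lambda>q. T_tilde v zs l q $ c $ d) q) \<and>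
    mat (var_z - var_w) ** tensor_bracket v (T_tilde v zs) (T_tilde v zs) q =
      commutator P12
        (leg1 (in_z (\<lambda>k. T_tilde v zs k q)) ** leg2 (in_w (\<lambda>l. T_tilde v zs l q)))"
proof (intro conjI allI)
  show "(\<lambda>i. v i ^ k * q (Xi a i) * q (Eta b i)) summable_on UNIV" for k a b
    using summable_mom[OF assms, of k a b UNIV] by (simp add: mult.assoc)
  show "bracket_exists v (\<lambda>q. T_tilde v zs k q $ a $ b) (\<lambda>q. T_tilde v zs l q $ c $ d) q"
    for k l a b c d
    by (rule bracket_exists_T_tilde[OF assms])
  let ?T = "\<lambda>k. T_tilde v zs k q"
  have "(mat (var_z - var_w) ** tensor_bracket v (T_tilde v zs) (T_tilde v zs) q) $ (a, c) $ (b, d) =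
      commutator P12 (leg1 (in_z ?T) ** leg2 (in_w ?T)) $ (a, c) $ (b, d)" for a b c d
  proof -
    let ?B = "\<lambda>k l. bracket v (\<lambda>q. T_tilde v zs k q $ a $ b) (\<lambda>q. T_tilde v zs l q $ c $ d) q"
    \<comment> \<open>Brackets with an index 0 vanish because the leading coefficient
      \<open>Z\<close> is constant on phase space.\<close>
    have "(var_z - var_w) * series_zw ?B = series_zw (\<lambda>k l. ?B (Suc k) l - ?B k (Suc l))"
      by (rule var_z_minus_var_w_times_series_zw) (simp_all add: bracket_T_tilde[OF assms])
    also have "\<dots> = series_zw (\<lambda>k l. ?T k $ c $ b * ?T l $ a $ d - ?T k $ a $ d * ?T l $ c $ b)"
      by (simp only: bracket_T_tilde_rec[OF assms])
    also have "\<dots> = in_z ?T $ c $ b * in_w ?T $ a $ d - in_z ?T $ a $ d * in_w ?T $ c $ b"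
      unfolding in_z_times_in_w by (intro fls_eqI) (simp add: series_zw_nth)
    finally show ?thesis
      by (simp add: mat_times_nth tensor_bracket_nth commutator_P12_nth leg1_times_leg2_nth)
  qed
  then show "mat (var_z - var_w) ** tensor_bracket v (T_tilde v zs) (T_tilde v zs) q =
      commutator P12 (leg1 (in_z ?T) ** leg2 (in_w ?T))"
    by (simp add: vec_eq_iff)
qed

end
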